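(* Let $q\ge 2$ be an even integer. For every even positive integer $n$, the number $M_{\rm PB}(n,q)$ of polarity-balanced sequences of length $n$ over ${\cal A}_q$ satisfies $$M_{\rm PB}(n,q)=\binom{n}{n/2}\left(\frac q2\right)^n ,$$ and, for fixed $q$, $$M_{\rm PB}(n,q)\approx q^n\sqrt{\frac{2}{\pi n}},$$ i.e. the ratio of the two sides tends to $1$ as $n\to\infty$ through even integers.
   Context: For an integer $q\ge 2$, ${\cal A}_q=\{-q+1,-q+3,-q+5,\ldots,q-3,q-1\}$ (a set of $q$ integers). A sequence ${\bf x}=(x_1,\ldots,x_n)\in({\cal A}_q)^n$ is polarity-balanced (PB) if $|\{i:x_i>0\}|=|\{i:x_i<0\}|$. $M_{\rm PB}(n,q)$ is the number of PB sequences in $({\cal A}_q)^n$. *)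

theory Defs
  imports "HOL-Analysis.Analysis"
begin

(* The symbols -q+1, -q+3, ..., q-3, q-1. *)
definition alphabet :: "nat \<Rightarrow> int set" where
  "alphabet q = (\<lambda>j. 2 * int j - int q + 1) ` {..<q}"

definition polarity_balanced :: "int list \<Rightarrow> bool" where
  "polarity_balanced xs \<longleftrightarrow>
     card {i. i < length xs \<and> xs ! i > 0} = card {i. i < length xs \<and> xs ! i < 0}"

definition M_PB :: "nat \<Rightarrow> nat \<Rightarrow> nat" where
  "M_PB n q = card {xs. length xs = n \<and> set xs \<subseteq> alphabet q \<and> polarity_balanced xs}"

end

(* An even alphabet splits into q/2 positive and q/2 negative symbols and has no zero symbol, so a
   sequence of length n is balanced iff exactly n/2 of its entries are positive. The m-th partial Wallis product is
   16^m / (binomial(2m,m)^2 (2m+1)), which yields the asymptotics of the central binomial coefficient. *)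
theory Submission
  imports Defs "HOL-Real_Asymp.Real_Asymp"
begin

text \<open>Choose the positions of the \<open>k\<close> entries satisfying \<open>P\<close>, then
  fill the two kinds of positions independently. Formally, induction on the length, splitting by the
  first entry; the two cases recombine by Pascal's rule.\<close>

lemma card_lists_filter_length_eq:
  assumes "finite A"
  shows "card {xs. length xs = n \<and> set xs \<subseteq> A \<and> length (filter P xs) = k} =
           (n choose k) * card {x \<in> A. P x} ^ k * card {x \<in> A. \<not> P x} ^ (n - k)"
proof (induction n arbitrary: k)
  case 0
  have "{xs. length xs = 0 \<and> set xs \<subseteq> A \<and> length (filter P xs) = k} = (if k = 0 then {[]} else {})"
    by auto
  then show ?case by (cases k) auto
next
  case (Suc n)
  define L where "L = (\<lambda>n k. {xs. length xs = n \<and> set xs \<subseteq> A \<and> length (filter P xs) = k})"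
  define T where "T = {x \<in> A. P x}"
  define F where "F = {x \<in> A. \<not> P x}"
  \<comment> \<open>\<open>U\<close> and \<open>V\<close> collect the lists whose head does or does
    not satisfy \<open>P\<close>. The case \<open>k = 0\<close> is separate because
    \<open>k - 1\<close> would truncate to \<open>0\<close> and produce spurious lists.\<close>
  define U where "U = (if k = 0 then {} else (\<lambda>(x, xs). x # xs) ` (T \<times> L n (k - 1)))"
  define V where "V = (\<lambda>(x, xs). x # xs) ` (F \<times> L n k)"
  have IH: "card (L n j) = (n choose j) * card T ^ j * card F ^ (n - j)" for j
    using Suc.IH[of j] by (simp add: L_def T_def F_def)
  have fin: "finite T" "finite F" "finite (L n j)" for j
    using assms finite_subset[OF _ finite_lists_length_eq[OF assms, of n], of "L n j"]
    by (auto simp: T_def F_def L_def)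
  have inj: "inj_on (\<lambda>(x, xs). x # xs) S" for S :: "('a \<times> 'a list) set"
    by (auto simp: inj_on_def)
  have split: "L (Suc n) k = U \<union> V"
  proof (intro set_eqI)
    fix ys
    show "ys \<in> L (Suc n) k \<longleftrightarrow> ys \<in> U \<union> V"
      by (cases ys) (auto simp: L_def U_def V_def T_def F_def image_iff)
  qed
  have "U \<inter> V = {}" by (auto simp: U_def V_def T_def F_def split: if_splits)
  then have "card (L (Suc n) k) = card U + card V"
    using fin by (subst split, subst card_Un_disjoint) (auto simp: U_def V_def)
  also have "card V = card F * card (L n k)"
    by (simp add: V_def card_image[OF inj] card_cartesian_product)
  also have "card U = (if k = 0 then 0 else card T * card (L n (k - 1)))"
    by (simp add: U_def card_image[OF inj] card_cartesian_product)
  also have "(if k = 0 then 0 else card T * card (L n (k - 1))) + card F * card (L n k) =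
      (Suc n choose k) * card T ^ k * card F ^ (Suc n - k)"
  proof (cases k)
    case 0
    then show ?thesis by (simp add: IH)
  next
    case (Suc j)
    show ?thesis
    \<comment> \<open>Merging the powers of \<open>card F\<close> needs
      \<open>Suc (n - k) = n - j\<close>, which fails under truncated subtraction when
      \<open>k > n\<close>; there the affected term vanishes, since its binomial coefficient is
      zero.\<close>
    proof (cases "k \<le> n")
      case True
      then have "n - j = Suc (n - k)" using Suc by simp
      then show ?thesis using Suc by (simp add: IH algebra_simps)
    next
      case False
      then have "n choose k = 0" by simp
      then show ?thesis using Suc by (simp add: IH algebra_simps)
    qed
  qed
  finally show ?case by (simp add: L_def T_def F_def)
qed

text \<open>The symbol with index \<open>j\<close> is positive iff 2j + 1 > q, which for even
  \<open>q\<close> means that \<open>j\<close> is at least \<open>q div 2\<close>.\<close>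

lemma card_alphabet_positive:
  assumes "even q"
  shows "card {x \<in> alphabet q. x > 0} = q div 2"
proof -
  have "{x \<in> alphabet q. x > 0} = (\<lambda>j. 2 * int j - int q + 1) ` {q div 2..<q}"
    using assms by (auto simp: alphabet_def elim!: evenE)
  moreover have "inj_on (\<lambda>j. 2 * int j - int q + 1) {q div 2..<q}"
    by (auto simp: inj_on_def)
  ultimately show ?thesis using assms by (auto simp: card_image elim!: evenE)
qed

lemma card_alphabet_not_positive:
  assumes "even q"
  shows "card {x \<in> alphabet q. \<not> x > 0} = q div 2"
proof -
  have "{x \<in> alphabet q. \<not> x > 0} = (\<lambda>j. 2 * int j - int q + 1) ` {..<q div 2}"
    using assms by (auto simp: alphabet_def elim!: evenE)
  moreover have "inj_on (\<lambda>j. 2 * int j - int q + 1) {..<q div 2}"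
    by (auto simp: inj_on_def)
  ultimately show ?thesis by (simp add: card_image)
qed

text \<open>Parity: for even \<open>q\<close> every symbol is odd.\<close>

lemma zero_notin_alphabet:
  assumes "even q"
  shows "0 \<notin> alphabet q"
proof
  assume "0 \<in> alphabet q"
  then obtain j where "2 * int j - int q + 1 = 0" by (auto simp: alphabet_def)
  then show False using assms by presburger
qed

text \<open>Without zero entries the positive and negative counts add up to the length, so they
  agree exactly when the positive count is half of it.\<close>

lemma polarity_balanced_iff_half_positive:
  assumes "0 \<notin> set xs" "even (length xs)"
  shows "polarity_balanced xs \<longleftrightarrow> length (filter (\<lambda>x. x > 0) xs) = length xs div 2"
proof -
  have "filter (\<lambda>x. \<not> x > 0) xs = filter (\<lambda>x. x < 0) xs"
    using assms(1) by (intro filter_cong) (auto simp: not_less order_le_less)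
  then have "length (filter (\<lambda>x. x > 0) xs) + length (filter (\<lambda>x. x < 0) xs) = length xs"
    using sum_length_filter_compl[of "\<lambda>x. x > 0" xs] by simp
  moreover have "polarity_balanced xs \<longleftrightarrow>
      length (filter (\<lambda>x. x > 0) xs) = length (filter (\<lambda>x. x < 0) xs)"
    by (simp add: polarity_balanced_def length_filter_conv_card)
  ultimately show ?thesis using assms(2) by presburger
qed

lemma M_PB_even:
  assumes "even q" "even n"
  shows "M_PB n q = (n choose (n div 2)) * (q div 2) ^ n"
proof -
  have "{xs. length xs = n \<and> set xs \<subseteq> alphabet q \<and> polarity_balanced xs} =
        {xs. length xs = n \<and> set xs \<subseteq> alphabet q \<and> length (filter (\<lambda>x. x > 0) xs) = n div 2}"
    using polarity_balanced_iff_half_positive zero_notin_alphabet[OF assms(1)] assms(2) by blast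
  moreover have "finite (alphabet q)" by (simp add: alphabet_def)
  ultimately have "M_PB n q = (n choose (n div 2)) * (q div 2) ^ (n div 2) * (q div 2) ^ (n - n div 2)"
    using assms(1)
    by (simp add: M_PB_def card_lists_filter_length_eq card_alphabet_positive
        card_alphabet_not_positive del: not_less)
  then show ?thesis by (simp add: mult.assoc flip: power_add)
qed

text \<open>Two absorption identities, passing through \<open>Suc (2 * m) choose m\<close>. This
  recurrence drives the induction for the Wallis product.\<close>

lemma central_binomial_Suc:
  "real (Suc m) * real (2 * Suc m choose Suc m) = 2 * (2 * real m + 1) * real (2 * m choose m)"
proof -
  have a: "Suc m * (2 * Suc m choose Suc m) = (2 * Suc m) * (Suc (2 * m) choose m)"
    using Suc_times_binomial[of m "Suc (2 * m)"] by simp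
  have b: "Suc m * (Suc (2 * m) choose m) = Suc (2 * m) * (2 * m choose m)"
    using binomial_absorb_comp[of "Suc (2 * m)" m] by simp
  have "Suc m * (2 * Suc m choose Suc m) = 2 * (Suc (2 * m) * (2 * m choose m))"
    using a b by simp
  then have "real (Suc m * (2 * Suc m choose Suc m)) = real (2 * (Suc (2 * m) * (2 * m choose m)))"
    by (rule arg_cong)
  then show ?thesis by (simp add: algebra_simps)
qed

lemma wallis_prod_central_binomial:
  "(\<Prod>k=1..m. (4 * real k ^ 2) / (4 * real k ^ 2 - 1)) =
     16 ^ m / (real (2 * m choose m) ^ 2 * (2 * real m + 1))"
proof (induction m)
  case 0
  show ?case by simp
next
  case (Suc m)
  define x c where "x = real m" and "c = real (2 * m choose m)"
  have pos: "x \<ge> 0" "c > 0" by (simp_all add: x_def c_def)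
  have d: "real (2 * Suc m choose Suc m) = 2 * (2 * x + 1) * c / (x + 1)"
    using central_binomial_Suc[of m] by (simp add: x_def c_def field_simps)
  \<comment> \<open>Difference of squares in the denominator of the new Wallis factor: 2x + 3 is the
    new odd factor 2(m + 1) + 1, and 2x + 1 joins the old one to form the square coming from the
    recurrence \<open>d\<close>.\<close>
  have s: "4 * (x + 1) ^ 2 - 1 = (2 * x + 1) * (2 * x + 3)"
    by (simp add: power2_eq_square algebra_simps)
  have "(\<Prod>k=1..Suc m. (4 * real k ^ 2) / (4 * real k ^ 2 - 1)) =
      16 ^ m / (c ^ 2 * (2 * x + 1)) * (4 * (x + 1) ^ 2 / (4 * (x + 1) ^ 2 - 1))"
    using Suc.IH by (simp add: x_def c_def add.commute)
  also have "\<dots> = 16 ^ Suc m / ((2 * (2 * x + 1) * c / (x + 1)) ^ 2 * (2 * (x + 1) + 1))"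
    unfolding s using pos by (simp add: divide_simps power2_eq_square) (simp add: algebra_simps)
  finally show ?case unfolding d by (simp add: x_def add.commute)
qed

text \<open>By the closed form of the Wallis product \<open>W\<close>, the square of the sequence is
  pi * (m / (2m + 1)) / W m, whose limit is pi * (1/2) / (pi/2) = 1.\<close>

lemma central_binomial_asymptotics:
  "(\<lambda>m. real (2 * m choose m) / 4 ^ m * sqrt (pi * real m)) \<longlonglongrightarrow> 1"
proof -
  define W where "W = (\<lambda>m. \<Prod>k=1..m. (4 * real k ^ 2) / (4 * real k ^ 2 - 1))"
  have "(\<lambda>m. real m / (2 * real m + 1)) \<longlonglongrightarrow> 1 / 2" by real_asymp
  moreover have "W \<longlonglongrightarrow> pi / 2" unfolding W_def by (rule wallis)
  ultimately have "(\<lambda>m. sqrt (pi * (real m / (2 * real m + 1)) / W m)) \<longlonglongrightarrow>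
      sqrt (pi * (1 / 2) / (pi / 2))"
    by (intro tendsto_real_sqrt tendsto_divide[where g = W] tendsto_mult tendsto_const) auto
  moreover have "sqrt (pi * (real m / (2 * real m + 1)) / W m) =
      real (2 * m choose m) / 4 ^ m * sqrt (pi * real m)" for m
  proof (rule real_sqrt_unique)
    have "(16 :: real) ^ m = (4 ^ m) ^ 2" by (simp add: power2_eq_square flip: power_mult_distrib)
    moreover have "2 * real m + 1 \<noteq> 0" by linarith
    ultimately show "(real (2 * m choose m) / 4 ^ m * sqrt (pi * real m))\<^sup>2 =
        pi * (real m / (2 * real m + 1)) / W m"
      unfolding W_def wallis_prod_central_binomial by (simp add: power_mult_distrib power_divide)
  qed auto
  ultimately show ?thesis by simp
qed

theorem theorem5:
  fixes q :: nat
  assumes "q \<ge> 2" and "even q"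
  shows "(\<forall>n. even n \<and> n > 0 \<longrightarrow> M_PB n q = (n choose (n div 2)) * (q div 2) ^ n) \<and>
         ((\<lambda>n. real (M_PB n q) / (real q ^ n * sqrt (2 / (pi * real n)))) \<longlongrightarrow> 1)
           (inf sequentially (principal {n. even n}))"
proof
  show "\<forall>n. even n \<and> n > 0 \<longrightarrow> M_PB n q = (n choose (n div 2)) * (q div 2) ^ n"
    using M_PB_even[OF assms(2)] by blast
  let ?R = "\<lambda>m. real (2 * m choose m) / 4 ^ m * sqrt (pi * real m)"
  \<comment> \<open>With n = 2m and q = 2p, the powers leave p^n / q^n = 1 / 4^m, and the root is 1
    / sqrt (pi m). The equality includes n = 0, where both sides are 0 because division by zero
    yields 0.\<close>
  have ratio: "?R (n div 2) = real (M_PB n q) / (real q ^ n * sqrt (2 / (pi * real n)))"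
    if "even n" for n
  proof -
    obtain m where n: "n = 2 * m" using \<open>even n\<close> by (blast elim: evenE)
    obtain p where q: "q = 2 * p" using assms(2) by (blast elim: evenE)
    have "p > 0" using assms(1) q by simp
    then show ?thesis
      using M_PB_even[OF assms(2) that]
      by (simp add: n q power_mult power_mult_distrib real_sqrt_divide)
  qed
  \<comment> \<open>Since \<open>n div 2\<close> tends to infinity along all naturals, the limit
    holds for the full sequence first and is then restricted to even \<open>n\<close>, where
    \<open>ratio\<close> applies.\<close>
  have "filterlim (\<lambda>n::nat. n div 2) sequentially sequentially"
    by (rule filterlim_at_top_div_const_nat) simp
  with central_binomial_asymptotics have "(\<lambda>n. ?R (n div 2)) \<longlonglongrightarrow> 1"
    by (rule filterlim_compose)
  then have "((\<lambda>n. ?R (n div 2)) \<longlongrightarrow> 1) (inf sequentially (principal {n. even n}))"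
    by (rule tendsto_mono[OF inf_le1])
  then show "((\<lambda>n. real (M_PB n q) / (real q ^ n * sqrt (2 / (pi * real n)))) \<longlongrightarrow> 1)
      (inf sequentially (principal {n. even n}))"
    by (rule Lim_transform_eventually) (use ratio in \<open>auto simp only: eventually_inf_principal mem_Collect_eq intro: always_eventually\<close>)
qed

end
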